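(* For every integer $n\ge 2$ there exists a constant $C(n)$, depending only on $n$, such that the following holds. Let $\Gamma\le \mathcal{S}_n$ be a transitive permutation group and let $z\in\mathbb{Z}^n$ be a core point with respect to $\Gamma$. Then there exists a nonzero $\Gamma$-invariant linear subspace $V$ of $\mathbb{R}^n$, different from $\operatorname{Fix}(\Gamma)=\operatorname{span}(\mathbb{1})$, such that $\|z|_V\|\le C(n)$.
   Context: $\mathcal{S}_n$ is the symmetric group on $[n]=\{1,\dots,n\}$; a subgroup $\Gamma\le\mathcal{S}_n$ acts on $\mathbb{R}^n$ by permuting coordinates. $\mathbb{1}$ is the all-ones vector. A point $z\in\mathbb{Z}^n$ is a core point with respect to $\Gamma$ if $\operatorname{conv}(\Gamma z)\cap\mathbb{Z}^n=\Gamma z$. A linear subspace $V\subseteq\mathbb{R}^n$ is $\Gamma$-invariant if $\Gamma V=V$ (setwise). $\operatorname{Fix}(\Gamma)$ is the subspace of vectors fixed pointwise by $\Gamma$ (which equals $\operatorname{span}(\mathbb{1})$ for transitive $\Gamma$). $z|_V$ denotes the orthogonal projection of $z$ onto $V$, and $\|\cdot\|$ is the Euclidean norm. *)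

theory Defs
  imports "HOL-Analysis.Analysis" "HOL-Algebra.Bij"
begin

text \<open>
  The index type \<open>'n\<close> plays the role of \<open>[n]\<close>, with \<open>n = CARD('n)\<close>; the group
  \<open>BijGroup (UNIV :: 'n set)\<close> is the symmetric group on it.
\<close>

definition transitive_permutation_group :: "('n \<Rightarrow> 'n) set \<Rightarrow> bool"
  where "transitive_permutation_group \<Gamma> \<longleftrightarrow>
    subgroup \<Gamma> (BijGroup UNIV) \<and> (\<forall>i j. \<exists>g\<in>\<Gamma>. g i = j)"

text \<open>The inverse makes this a left action: it sends \<open>axis i 1\<close> to \<open>axis (g i) 1\<close>.\<close>

definition permute_coords :: "('n \<Rightarrow> 'n) \<Rightarrow> real ^ 'n \<Rightarrow> real ^ 'n"
  where "permute_coords g x = (\<chi> i. x $ inv_into UNIV g i)"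

definition perm_orbit :: "('n \<Rightarrow> 'n) set \<Rightarrow> real ^ 'n \<Rightarrow> (real ^ 'n) set"
  where "perm_orbit \<Gamma> x = (\<lambda>g. permute_coords g x) ` \<Gamma>"

definition integer_lattice :: "(real ^ 'n) set"
  where "integer_lattice = {x. \<forall>i. x $ i \<in> \<int>}"

definition core_point :: "('n::finite \<Rightarrow> 'n) set \<Rightarrow> real ^ 'n \<Rightarrow> bool"
  where "core_point \<Gamma> z \<longleftrightarrow>
    z \<in> integer_lattice \<and> convex hull (perm_orbit \<Gamma> z) \<inter> integer_lattice = perm_orbit \<Gamma> z"

definition invariant_subspace :: "('n::finite \<Rightarrow> 'n) set \<Rightarrow> (real ^ 'n) set \<Rightarrow> bool"
  where "invariant_subspace \<Gamma> V \<longleftrightarrow> subspace V \<and> (\<forall>g\<in>\<Gamma>. permute_coords g ` V = V)"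

definition fixed_space :: "('n \<Rightarrow> 'n) set \<Rightarrow> (real ^ 'n) set"
  where "fixed_space \<Gamma> = {x. \<forall>g\<in>\<Gamma>. permute_coords g x = x}"

definition orthogonal_projection :: "'a::euclidean_space set \<Rightarrow> 'a \<Rightarrow> 'a"
  where "orthogonal_projection V x = (THE p. p \<in> V \<and> (\<forall>v\<in>V. orthogonal (x - p) v))"

lemma orthogonal_projection:
  assumes "subspace V"
  shows "orthogonal_projection V x \<in> V"
    and "v \<in> V \<Longrightarrow> orthogonal (x - orthogonal_projection V x) v"
proof -
  obtain y z where yz: "y \<in> span V" "\<And>w. w \<in> span V \<Longrightarrow> orthogonal z w" "x = y + z"
    using orthogonal_subspace_decomp_exists[of V x] by blast
  have V: "span V = V"
    using assms by (simp add: span_eq_iff)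
  have "\<exists>!p. p \<in> V \<and> (\<forall>v\<in>V. orthogonal (x - p) v)"
  proof (rule ex1I)
    show "y \<in> V \<and> (\<forall>v\<in>V. orthogonal (x - y) v)"
      using yz V by auto
  next
    fix p assume p: "p \<in> V \<and> (\<forall>v\<in>V. orthogonal (x - p) v)"
    have d: "p - y \<in> V"
      using p yz(1) V assms by (simp add: subspace_diff)
    then have "(x - p) \<bullet> (p - y) = 0" "(x - y) \<bullet> (p - y) = 0"
      using p yz V by (auto simp: orthogonal_def)
    then have "(p - y) \<bullet> (p - y) = 0"
      by (simp add: inner_diff_left)
    then show "p = y" by simp
  qed
  from theI'[OF this] show "orthogonal_projection V x \<in> V"
    and "v \<in> V \<Longrightarrow> orthogonal (x - orthogonal_projection V x) v"
    unfolding orthogonal_projection_def by auto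
qed

lemma fixed_space_transitive:
  fixes \<Gamma> :: "('n::finite \<Rightarrow> 'n) set"
  assumes "transitive_permutation_group \<Gamma>"
  shows "fixed_space \<Gamma> = span {1}"
proof (intro Set.set_eqI iffI)
  fix x :: "real ^ 'n"
  assume x: "x \<in> fixed_space \<Gamma>"
  obtain i0 :: 'n where True by simp
  have "x $ j = x $ i0" for j
  proof -
    obtain g where g: "g \<in> \<Gamma>" "g i0 = j"
      using assms by (auto simp: transitive_permutation_group_def)
    have "\<Gamma> \<subseteq> Bij UNIV"
      using assms subgroup.subset
      by (fastforce simp: transitive_permutation_group_def BijGroup_def)
    then have "bij g"
      using g(1) by (auto simp: Bij_def)
    then have "inv_into UNIV g j = i0"
      using g(2) by (auto simp: bij_is_inj)
    moreover have "permute_coords g x $ j = x $ j"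
      using x g(1) by (simp add: fixed_space_def)
    ultimately show ?thesis by (simp add: permute_coords_def)
  qed
  then have "x = (x $ i0) *\<^sub>R 1"
    by (simp add: vec_eq_iff)
  then show "x \<in> span {1}"
    by (metis span_base span_scale insertI1)
next
  fix x :: "real ^ 'n"
  assume "x \<in> span {1}"
  then obtain k where "x = k *\<^sub>R 1" by (auto simp: span_singleton)
  then show "x \<in> fixed_space \<Gamma>"
    by (simp add: fixed_space_def permute_coords_def vec_eq_iff)
qed

end

theory Submission
  imports Defs
begin

text \<open>
  Let \<open>b\<close> be the barycentre of the orbit of \<open>z\<close> and \<open>p\<close> an integer point with the same
  coordinate sum near \<open>b\<close>. If \<open>p\<close> lies in the orbit polytope, it is a vertex because \<open>z\<close> is a
  core point, so \<open>z\<close> itself is close to \<open>b\<close> and \<open>V\<close> can be the orthogonal complement of the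
  all-ones vector. Otherwise a hyperplane separates \<open>p\<close> from the polytope; its unit normal \<open>u\<close>
  can be taken orthogonal to the all-ones vector. The numbers \<open>u \<bullet> g z\<close> are bounded below
  and sum to zero over the group, hence are bounded in absolute value. The operator
  \<open>T x = (\<Sum>g. (x \<bullet> g u) g u)\<close> commutes with the group, so its top eigenspace is invariant; as
  the top eigenvalue is at least 1, the projection of \<open>z\<close> onto that eigenspace is controlled by
  \<open>T z \<bullet> z = (\<Sum>g. (z \<bullet> g u)\<^sup>2)\<close>.
\<close>

section \<open>Top eigenvectors of self-adjoint operators\<close>

text \<open>The quadratic form attains its maximum \<open>l\<close> on the compact unit sphere; a
  first-order variation at a maximiser \<open>e\<close> forces \<open>f e\<close> to be parallel to
  \<open>e\<close>.\<close>

lemma selfadjoint_top_eigenvector: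
  fixes f :: "'a::euclidean_space \<Rightarrow> 'a"
  assumes lin: "linear f" and self: "\<And>x y. f x \<bullet> y = x \<bullet> f y"
  obtains l e where "e \<noteq> 0" "f e = l *\<^sub>R e" "\<And>x. f x \<bullet> x \<le> l * (x \<bullet> x)"
proof -
  have "continuous_on (sphere 0 1) (\<lambda>x. f x \<bullet> x)"
    by (intro continuous_intros linear_continuous_on linear_conv_bounded_linear[THEN iffD1] lin)
  moreover have "sphere (0::'a) 1 \<noteq> {}" by simp
  ultimately obtain e where e: "e \<in> sphere 0 1" "\<And>y. y \<in> sphere 0 1 \<Longrightarrow> f y \<bullet> y \<le> f e \<bullet> e"
    using continuous_attains_sup[of "sphere (0::'a) 1" "\<lambda>x. f x \<bullet> x"] by auto
  define l where "l = f e \<bullet> e"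
  have ee: "e \<bullet> e = 1" using e(1) by (simp add: norm_eq_1)
  have max: "f x \<bullet> x \<le> l * (x \<bullet> x)" for x
  proof (cases "x = 0")
    case True then show ?thesis by (simp add: linear_0[OF lin])
  next
    case False
    have "f (x /\<^sub>R norm x) \<bullet> (x /\<^sub>R norm x) \<le> l"
      unfolding l_def using False by (intro e(2)) simp
    then have "(f x \<bullet> x) / (norm x * norm x) \<le> l"
      by (simp add: linear_scale[OF lin] divide_simps)
    then show ?thesis
      using False by (simp add: divide_simps dot_square_norm power2_eq_square)
  qed
  have "f e = l *\<^sub>R e"
  proof (rule ccontr)
    define y where "y = f e - l *\<^sub>R e"
    assume "f e \<noteq> l *\<^sub>R e"
    then have "y \<noteq> 0" by (simp add: y_def)
    define a where "a = y \<bullet> y"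
    have a: "a > 0" using \<open>y \<noteq> 0\<close> by (simp add: a_def)
    define q where "q = l * (y \<bullet> y) - f y \<bullet> y"
    \<comment> \<open>The Rayleigh quotient would increase in the direction of \<open>y\<close>.\<close>
    have key: "2 * t * a \<le> t\<^sup>2 * q" for t
    proof -
      have "f (e + t *\<^sub>R y) \<bullet> (e + t *\<^sub>R y) = l + 2 * t * (f e \<bullet> y) + t\<^sup>2 * (f y \<bullet> y)"
        using self[of y e]
        by (simp add: linear_add[OF lin] linear_scale[OF lin] inner_simps l_def
            power2_eq_square algebra_simps inner_commute)
      moreover have "(e + t *\<^sub>R y) \<bullet> (e + t *\<^sub>R y) = 1 + 2 * t * (e \<bullet> y) + t\<^sup>2 * (y \<bullet> y)"
        using ee by (simp add: inner_simps power2_eq_square algebra_simps inner_commute)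
      moreover have "f e \<bullet> y = a + l * (e \<bullet> y)"
        by (simp add: a_def y_def inner_simps algebra_simps)
      ultimately show ?thesis
        using max[of "e + t *\<^sub>R y"] by (simp add: q_def algebra_simps)
    qed
    \<comment> \<open>Any positive \<open>t\<close> with \<open>t * q < 2 * a\<close> contradicts
      \<open>key\<close>; the \<open>+ 1\<close> keeps the denominator positive when
      \<open>q = 0\<close>.\<close>
    define t where "t = a / (\<bar>q\<bar> + 1)"
    have t: "t > 0" using a by (simp add: t_def)
    have "2 * a \<le> t * q"
      using key[of t] t by (simp add: power2_eq_square algebra_simps)
    also have "\<dots> \<le> t * (\<bar>q\<bar> + 1)" using t by (intro mult_left_mono) auto
    also have "\<dots> = a" by (simp add: t_def)
    finally show False using a by simp
  qed
  moreover have "e \<noteq> 0" using ee by auto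
  ultimately show thesis using that max by blast
qed

section \<open>The orthogonal action on coordinates\<close>

lemma linear_permute_coords: "linear (permute_coords g)"
  by (auto intro!: linearI simp: permute_coords_def vec_eq_iff)

lemma permute_coords_one [simp]: "permute_coords g 1 = 1"
  by (simp add: permute_coords_def vec_eq_iff)

lemma inner_permute_coords:
  fixes x y :: "real ^ 'n::finite"
  assumes "bij g"
  shows "permute_coords g x \<bullet> permute_coords g y = x \<bullet> y"
  using sum.reindex_bij_betw[OF bij_imp_bij_inv[OF assms], of "\<lambda>i. x $ i * y $ i"]
  by (simp add: permute_coords_def inner_vec_def)

lemma permute_coords_comp:
  "bij g \<Longrightarrow> bij h \<Longrightarrow> permute_coords (g \<circ> h) x = permute_coords g (permute_coords h x)"
  by (simp add: permute_coords_def vec_eq_iff o_inv_distrib)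

lemma permute_coords_inv:
  assumes "bij g"
  shows "permute_coords (inv_into UNIV g) (permute_coords g x) = x"
    and "permute_coords g (permute_coords (inv_into UNIV g) x) = x"
  using assms by (simp_all add: permute_coords_def vec_eq_iff inv_inv_eq bij_is_inj bij_is_surj surj_f_inv_f)

lemma inner_permute_coords_left:
  fixes x y :: "real ^ 'n::finite"
  assumes "bij g"
  shows "permute_coords g x \<bullet> y = x \<bullet> permute_coords (inv_into UNIV g) y"
  using inner_permute_coords[OF assms, of x "permute_coords (inv_into UNIV g) y"]
  by (simp add: permute_coords_inv[OF assms])

section \<open>Group sums and invariant subspaces\<close>

context
  fixes \<Gamma> :: "('n::finite \<Rightarrow> 'n) set"
  assumes sub: "subgroup \<Gamma> (BijGroup UNIV)"
begin

lemma permutation_group_bij: "g \<in> \<Gamma> \<Longrightarrow> bij g"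
  using subgroup.subset[OF sub] by (auto simp: BijGroup_def Bij_def)

lemma permutation_group_comp: "g \<in> \<Gamma> \<Longrightarrow> h \<in> \<Gamma> \<Longrightarrow> g \<circ> h \<in> \<Gamma>"
  using subgroup.m_closed[OF sub, of g h] subgroup.subset[OF sub]
  by (auto simp: BijGroup_def compose_def o_def subset_iff restrict_def)

lemma permutation_group_id: "id \<in> \<Gamma>"
  using subgroup.one_closed[OF sub] by (simp add: BijGroup_def id_def restrict_def)

lemma permutation_group_inv: "g \<in> \<Gamma> \<Longrightarrow> inv_into UNIV g \<in> \<Gamma>"
  using subgroup.m_inv_closed[OF sub, of g] permutation_group_bij[of g]
  by (simp add: inv_BijGroup Bij_def restrict_def)

text \<open>Left translation by \<open>g\<close> permutes \<open>\<Gamma>\<close>; this makes orbit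
  sums fixed and the operator \<open>T\<close> below equivariant.\<close>

lemma sum_permutation_group_shift:
  assumes "g \<in> \<Gamma>"
  shows "(\<Sum>h\<in>\<Gamma>. F (g \<circ> h)) = (\<Sum>h\<in>\<Gamma>. F h)"
proof (rule sum.reindex_bij_witness[where i = "\<lambda>h. inv_into UNIV g \<circ> h" and j = "\<lambda>h. g \<circ> h"])
  show "inv_into UNIV g \<circ> h \<in> \<Gamma>" "g \<circ> h \<in> \<Gamma>" if "h \<in> \<Gamma>" for h
    using assms that by (auto intro: permutation_group_comp permutation_group_inv)
  show "inv_into UNIV g \<circ> (g \<circ> h) = h" "g \<circ> (inv_into UNIV g \<circ> h) = h" for h
    using permutation_group_bij[OF assms]
    by (simp_all add: fun_eq_iff bij_is_inj bij_is_surj surj_f_inv_f)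
qed auto

text \<open>Stability under the inverse of \<open>g\<close>, which also lies in
  \<open>\<Gamma>\<close>, supplies the preimages.\<close>

lemma invariant_subspaceI:
  assumes V: "subspace V" and stable: "\<And>g x. g \<in> \<Gamma> \<Longrightarrow> x \<in> V \<Longrightarrow> permute_coords g x \<in> V"
  shows "invariant_subspace \<Gamma> V"
  unfolding invariant_subspace_def
proof (intro conjI ballI equalityI V)
  fix g assume g: "g \<in> \<Gamma>"
  then show "permute_coords g ` V \<subseteq> V" using stable by blast
  show "V \<subseteq> permute_coords g ` V"
  proof
    fix x assume "x \<in> V"
    then have "permute_coords g (permute_coords (inv_into UNIV g) x) \<in> permute_coords g ` V"
      by (intro imageI stable permutation_group_inv g)
    then show "x \<in> permute_coords g ` V"
      by (simp only: permute_coords_inv[OF permutation_group_bij[OF g]])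
  qed
qed

lemma sum_orbit_fixed: "(\<Sum>g\<in>\<Gamma>. permute_coords g x) \<in> fixed_space \<Gamma>"
proof -
  have "permute_coords g (\<Sum>h\<in>\<Gamma>. permute_coords h x) = (\<Sum>h\<in>\<Gamma>. permute_coords h x)" if "g \<in> \<Gamma>" for g
  proof -
    have "permute_coords g (\<Sum>h\<in>\<Gamma>. permute_coords h x) = (\<Sum>h\<in>\<Gamma>. permute_coords (g \<circ> h) x)"
      using that by (simp add: linear_sum[OF linear_permute_coords] permute_coords_comp permutation_group_bij)
    then show ?thesis using sum_permutation_group_shift[OF that] by simp
  qed
  then show ?thesis by (simp add: fixed_space_def)
qed

text \<open>\<open>V\<close> is the top eigenspace of the frame operator \<open>T\<close> of the
  orbit of \<open>u\<close>. The conclusion \<open>1 \<notin> V\<close> later distinguishes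
  \<open>V\<close> from the fixed space.\<close>

lemma invariant_subspace_small_projection:
  fixes u z :: "real ^ 'n" and B :: real
  assumes u: "norm u = 1" "u \<bullet> 1 = 0"
    and B: "\<And>g. g \<in> \<Gamma> \<Longrightarrow> \<bar>u \<bullet> permute_coords g z\<bar> \<le> B"
  obtains V where "invariant_subspace \<Gamma> V" "V \<noteq> {0}" "1 \<notin> V"
    "(norm (orthogonal_projection V z))\<^sup>2 \<le> card \<Gamma> * B\<^sup>2"
proof -
  define T where "T x = (\<Sum>g\<in>\<Gamma>. (x \<bullet> permute_coords g u) *\<^sub>R permute_coords g u)" for x
  have lin: "linear T"
    by (rule linearI)
      (simp_all add: T_def inner_add_left scaleR_add_left sum.distrib scaleR_sum_right)
  have Tin: "T x \<bullet> y = (\<Sum>g\<in>\<Gamma>. (x \<bullet> permute_coords g u) * (y \<bullet> permute_coords g u))" for x y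
    by (simp add: T_def inner_sum_right inner_commute)
  have self: "T x \<bullet> y = x \<bullet> T y" for x y
    using Tin[of x y] Tin[of y x] by (simp add: inner_commute[of x] mult.commute)
  have Tnonneg: "T x \<bullet> x \<ge> 0" for x
    by (simp add: Tin sum_nonneg)
  have comm: "T (permute_coords g x) = permute_coords g (T x)" if g: "g \<in> \<Gamma>" for g x
  proof -
    have "T (permute_coords g x) =
      (\<Sum>h\<in>\<Gamma>. (permute_coords g x \<bullet> permute_coords (g \<circ> h) u) *\<^sub>R permute_coords (g \<circ> h) u)"
      unfolding T_def by (rule sum_permutation_group_shift[OF g, symmetric])
    also have "\<dots> = (\<Sum>h\<in>\<Gamma>. (x \<bullet> permute_coords h u) *\<^sub>R permute_coords g (permute_coords h u))"
      using g by (intro sum.cong refl)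
        (simp add: permute_coords_comp inner_permute_coords permutation_group_bij)
    finally show ?thesis
      by (simp add: T_def linear_sum[OF linear_permute_coords] linear_scale[OF linear_permute_coords])
  qed
  obtain l e where e: "e \<noteq> 0" "T e = l *\<^sub>R e" "\<And>x. T x \<bullet> x \<le> l * (x \<bullet> x)"
    using selfadjoint_top_eigenvector[OF lin self] by metis
  have uu: "u \<bullet> u = 1" using u(1) by (simp add: norm_eq_1)
  \<comment> \<open>The summand of the identity already contributes 1 to the quadratic form at \<open>u\<close>.\<close>
  have "1 \<le> T u \<bullet> u"
  proof -
    have "(u \<bullet> permute_coords id u) * (u \<bullet> permute_coords id u) \<le> T u \<bullet> u"
      unfolding Tin by (rule member_le_sum[OF permutation_group_id]) simp_all
    then show ?thesis by (simp add: permute_coords_def uu)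
  qed
  then have l: "l \<ge> 1" using e(3)[of u] uu by simp
  define V where "V = {x. T x = l *\<^sub>R x}"
  have V: "subspace V"
    by (auto simp: V_def subspace_def linear_0[OF lin] linear_add[OF lin] linear_scale[OF lin] algebra_simps)
  have inv: "invariant_subspace \<Gamma> V"
    by (rule invariant_subspaceI[OF V]) (simp add: V_def comm linear_scale[OF linear_permute_coords])
  \<comment> \<open>On \<open>V\<close> the operator scales by \<open>l \<ge> 1\<close>, so a vector
    killed by \<open>T\<close> lies in \<open>V\<close> only if it is zero.\<close>
  have "T 1 = 0"
    unfolding T_def
  proof (rule sum.neutral, rule ballI)
    fix g assume "g \<in> \<Gamma>"
    then have "(1::real^'n) \<bullet> permute_coords g u = 0"
      using inner_permute_coords[OF permutation_group_bij, of g 1 u] u(2) by (simp add: inner_commute)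
    then show "((1::real^'n) \<bullet> permute_coords g u) *\<^sub>R permute_coords g u = 0" by simp
  qed
  then have one: "1 \<notin> V" using l by (auto simp: V_def)
  define v where "v = orthogonal_projection V z"
  define w where "w = z - v"
  have v: "T v = l *\<^sub>R v" using orthogonal_projection(1)[OF V, of z] by (simp add: V_def v_def)
  have "w \<bullet> v = 0"
    using orthogonal_projection[OF V] by (simp add: v_def w_def orthogonal_def)
  \<comment> \<open>As \<open>T v\<close> is a multiple of \<open>v\<close> and \<open>T\<close> is
    self-adjoint, the cross terms of the form at \<open>z = v + w\<close> vanish.\<close>
  then have wv: "T v \<bullet> w = 0" "T w \<bullet> v = 0"
    using self[of w v] by (simp_all add: v inner_commute)
  have "(norm v)\<^sup>2 \<le> l * (v \<bullet> v)"
    using l mult_right_mono[OF l, of "v \<bullet> v"] by (simp add: power2_norm_eq_inner)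
  also have "\<dots> \<le> T v \<bullet> v + T w \<bullet> w"
    using Tnonneg[of w] by (simp add: v)
  also have "\<dots> = T (v + w) \<bullet> (v + w)"
    using wv by (simp add: linear_add[OF lin] inner_simps)
  also have "\<dots> = T z \<bullet> z" by (simp add: w_def)
  also have "\<dots> \<le> (\<Sum>g\<in>\<Gamma>. B\<^sup>2)"
    unfolding Tin
  proof (rule sum_mono)
    fix g assume g: "g \<in> \<Gamma>"
    \<comment> \<open>The hypothesis permutes \<open>z\<close>, while \<open>T\<close> permutes
      \<open>u\<close>; passing to the inverse of \<open>g\<close> exchanges the two.\<close>
    have "\<bar>z \<bullet> permute_coords g u\<bar> \<le> B"
      using B[OF permutation_group_inv[OF g]] inner_permute_coords_left[OF permutation_group_bij[OF g], of u z]
      by (simp add: inner_commute)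
    then show "(z \<bullet> permute_coords g u) * (z \<bullet> permute_coords g u) \<le> B\<^sup>2"
      using power_mono[of "\<bar>z \<bullet> permute_coords g u\<bar>" B 2] by (simp add: power2_eq_square)
  qed
  finally have "(norm v)\<^sup>2 \<le> card \<Gamma> * B\<^sup>2" by simp
  moreover have "V \<noteq> {0}" using e by (auto simp: V_def)
  ultimately show thesis using that inv one by (simp add: v_def)
qed

end

section \<open>Integer points near the diagonal\<close>

text \<open>With \<open>s = k\<close>, give every coordinate the value \<open>k div n\<close> and
  raise \<open>k mod n\<close> of them by 1. Each coordinate is then within 1 of the mean, and the
  l1 norm bounds the Euclidean one.\<close>

lemma integer_point_near_diagonal:
  assumes "s \<in> \<int>"
  obtains p :: "real ^ 'n::finite" where "p \<in> integer_lattice" "p \<bullet> 1 = s"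
    "norm (p - (s / CARD('n)) *\<^sub>R 1) \<le> CARD('n)"
proof -
  obtain k where k: "s = of_int k" using assms by (auto elim: Ints_cases)
  define n where "n = int CARD('n)"
  have n: "n > 0" by (simp add: n_def)
  define r where "r = nat (k mod n)"
  have r: "int r = k mod n" "r \<le> CARD('n)"
    using n pos_mod_bound[OF n, of k] by (simp_all add: r_def n_def nat_le_iff less_imp_le)
  then obtain S :: "'n set" where S: "card S = r"
    using obtain_subset_with_card_n[of r UNIV] by metis
  define p :: "real ^ 'n" where "p = (\<chi> i. of_int (k div n) + (if i \<in> S then 1 else 0))"
  have n_real: "real_of_int n = CARD('n)" by (simp add: n_def)
  have "real_of_int k = real_of_int (k div n * n + k mod n)" by (simp only: div_mult_mod_eq)
  then have s: "s = of_int (k div n) * of_int n + of_int (k mod n)" by (simp only: k of_int_add of_int_mult)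
  have "p \<bullet> 1 = of_int (k div n) * real CARD('n) + real (card S)"
    by (simp add: p_def inner_vec_def sum.distrib sum.If_cases)
  also have "\<dots> = s"
    using arg_cong[OF r(1), of real_of_int] by (simp add: S s n_real)
  finally have sum: "p \<bullet> 1 = s" .
  have le: "\<bar>(p - (s / CARD('n)) *\<^sub>R 1) $ i\<bar> \<le> 1" for i
  proof -
    have "s / CARD('n) = of_int (k div n) + of_int (k mod n) / of_int n"
      using n unfolding s n_real[symmetric] by (simp add: add_divide_distrib)
    moreover have "0 \<le> real_of_int (k mod n) / of_int n" "real_of_int (k mod n) / of_int n \<le> 1"
      using n pos_mod_bound[OF n, of k] pos_mod_sign[OF n, of k] by (simp_all add: divide_simps)
    ultimately show ?thesis by (auto simp: p_def)
  qed
  have "norm (p - (s / CARD('n)) *\<^sub>R 1) \<le> (\<Sum>i\<in>UNIV. \<bar>(p - (s / CARD('n)) *\<^sub>R 1) $ i\<bar>)"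
    by (rule norm_le_l1_cart)
  also have "\<dots> \<le> (\<Sum>i\<in>(UNIV::'n set). 1)" by (rule sum_mono) (rule le)
  finally have "norm (p - (s / CARD('n)) *\<^sub>R 1) \<le> CARD('n)" by simp
  moreover have "p \<in> integer_lattice" by (simp add: p_def integer_lattice_def)
  ultimately show thesis using that sum by blast
qed

text \<open>By transitivity the orbit sum is a multiple of the all-ones vector, so the inner
  products with \<open>u\<close> sum to zero. Adding \<open>R\<close> makes each one nonnegative,
  hence at most the total \<open>card \<Gamma> * R\<close>.\<close>

lemma inner_orbit_bound:
  fixes u z :: "real ^ 'n::finite" and R :: real
  assumes \<Gamma>: "transitive_permutation_group \<Gamma>" and u: "u \<bullet> 1 = 0"
    and low: "\<And>g. g \<in> \<Gamma> \<Longrightarrow> - R \<le> u \<bullet> permute_coords g z" and g: "g \<in> \<Gamma>"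
  shows "\<bar>u \<bullet> permute_coords g z\<bar> \<le> card \<Gamma> * R"
proof -
  have sub: "subgroup \<Gamma> (BijGroup UNIV)" using \<Gamma> by (simp add: transitive_permutation_group_def)
  have "(\<Sum>g\<in>\<Gamma>. permute_coords g z) \<in> span {1}"
    using sum_orbit_fixed[OF sub, of z] fixed_space_transitive[OF \<Gamma>] by simp
  then have zero: "(\<Sum>h\<in>\<Gamma>. u \<bullet> permute_coords h z) = 0"
    using u by (auto simp: span_singleton simp flip: inner_sum_right)
  have "u \<bullet> permute_coords g z + R \<le> (\<Sum>h\<in>\<Gamma>. u \<bullet> permute_coords h z + R)"
    by (rule member_le_sum[OF g]) (use low in fastforce)+
  then have up: "u \<bullet> permute_coords g z + R \<le> card \<Gamma> * R"
    by (simp add: sum.distrib zero)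
  have "0 \<le> (\<Sum>h\<in>\<Gamma>. u \<bullet> permute_coords h z + R)"
    by (intro sum_nonneg) (use low in fastforce)
  then have "0 \<le> card \<Gamma> * R" by (simp add: sum.distrib zero)
  moreover have "card \<Gamma> > 0" using g by (auto simp: card_gt_0_iff)
  ultimately have R: "0 \<le> R" by (metis of_nat_0_less_iff zero_le_mult_iff not_less)
  then have "R \<le> card \<Gamma> * R" using mult_right_mono[of 1 "real (card \<Gamma>)" R] \<open>card \<Gamma> > 0\<close> by simp
  then show ?thesis using up low[OF g] R by linarith
qed

section \<open>Core points: a nearby integer point inside or outside the orbit polytope\<close>

theorem theorem9:
  assumes "CARD('n::finite) \<ge> 2"
  shows "\<exists>C::real. \<forall>(\<Gamma> :: ('n \<Rightarrow> 'n) set) (z :: real ^ 'n).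
    transitive_permutation_group \<Gamma> \<longrightarrow> core_point \<Gamma> z \<longrightarrow>
    (\<exists>V. invariant_subspace \<Gamma> V \<and> V \<noteq> {0} \<and> V \<noteq> fixed_space \<Gamma> \<and>
      norm (orthogonal_projection V z) \<le> C)"
proof -
  \<comment> \<open>Counting all self-maps bounds \<open>card \<Gamma>\<close> in terms of the
    degree alone.\<close>
  define N where "N = real CARD('n \<Rightarrow> 'n)"
  define R where "R = real CARD('n)"
  have "CARD('n \<Rightarrow> 'n) > 0" by (rule zero_less_card_finite)
  then have N: "N \<ge> 1" by (simp add: N_def)
  have R: "R \<ge> 0" by (simp add: R_def)
  show ?thesis
  \<comment> \<open>One factor \<open>N\<close> bounds the inner products by \<open>N * R\<close>;
    the other dominates the square root of \<open>card \<Gamma>\<close> coming from the sum over the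
    group.\<close>
  proof (intro exI[of _ "R * N\<^sup>2"] allI impI)
    fix \<Gamma> :: "('n \<Rightarrow> 'n) set" and z :: "real ^ 'n"
    assume \<Gamma>: "transitive_permutation_group \<Gamma>" and core: "core_point \<Gamma> z"
    have sub: "subgroup \<Gamma> (BijGroup UNIV)" using \<Gamma> by (simp add: transitive_permutation_group_def)
    have one: "1 \<in> fixed_space \<Gamma>" by (simp add: fixed_space_def)
    define s where "s = z \<bullet> 1"
    have orbit_sum: "permute_coords g z \<bullet> 1 = s" if "g \<in> \<Gamma>" for g
      using inner_permute_coords[OF permutation_group_bij[OF sub that], of z 1] by (simp add: s_def)
    have "s \<in> \<int>"
      using core by (auto simp: s_def core_point_def integer_lattice_def inner_vec_def)
    then obtain p :: "real ^ 'n" where p: "p \<in> integer_lattice" "p \<bullet> 1 = s" "norm (p - (s / R) *\<^sub>R 1) \<le> R"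
      unfolding R_def using integer_point_near_diagonal by blast
    have one_one: "(1::real^'n) \<bullet> 1 = R" by (simp add: inner_vec_def R_def)
    have R_le: "R \<le> R * N\<^sup>2" using N R mult_left_mono[of 1 "N\<^sup>2" R] by simp
    show "\<exists>V. invariant_subspace \<Gamma> V \<and> V \<noteq> {0} \<and> V \<noteq> fixed_space \<Gamma> \<and>
        norm (orthogonal_projection V z) \<le> R * N\<^sup>2"
    proof (cases "p \<in> convex hull (perm_orbit \<Gamma> z)")
      case True
      \<comment> \<open>The core point property enters here: an integer point of the hull lies in
        the orbit.\<close>
      then obtain g where g: "g \<in> \<Gamma>" "p = permute_coords g z"
        using p(1) core by (auto simp: core_point_def perm_orbit_def)
      define V where "V = {x :: real ^ 'n. x \<bullet> 1 = 0}"
      have V: "subspace V" by (auto simp: V_def subspace_def inner_simps)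
      have inv: "invariant_subspace \<Gamma> V"
      proof (rule invariant_subspaceI[OF sub V])
        fix h and x :: "real ^ 'n" assume "h \<in> \<Gamma>" "x \<in> V"
        then show "permute_coords h x \<in> V"
          using inner_permute_coords[OF permutation_group_bij[OF sub], of h x 1] by (simp add: V_def)
      qed
      have "1 \<notin> V" using one_one by (simp add: V_def R_def)
      then have neq: "V \<noteq> fixed_space \<Gamma>" using one by blast
      obtain i j :: 'n where ij: "i \<noteq> j"
        using assms card_le_Suc0_iff_eq[of "UNIV :: 'n set"] by fastforce
      have "axis i 1 - axis j 1 \<in> V" "axis i 1 - axis j 1 \<noteq> (0::real^'n)"
        using ij by (auto simp: V_def inner_diff_left inner_axis' axis_eq_axis)
      then have nz: "V \<noteq> {0}" by blast
      define v where "v = orthogonal_projection V z"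
      have v: "v \<bullet> 1 = 0" "\<And>x. x \<bullet> 1 = 0 \<Longrightarrow> (z - v) \<bullet> x = 0"
        using orthogonal_projection[OF V] by (auto simp: V_def v_def orthogonal_def)
      define c where "c = z - (s / R) *\<^sub>R 1"
      have c1: "c \<bullet> 1 = 0" using one_one R_def by (simp add: c_def inner_simps s_def)
      \<comment> \<open>This identifies the projection \<open>v\<close> with \<open>c\<close>: the
        difference lies in \<open>V\<close> and is orthogonal to itself.\<close>
      have "(c - v) \<bullet> (c - v) = (z - v) \<bullet> (c - v) - (s / R) * ((c - v) \<bullet> 1)"
        by (simp add: c_def inner_simps algebra_simps inner_commute)
      also have "\<dots> = 0" using v c1 by (simp add: inner_simps)
      finally have vc: "v = c" by simp
      have "permute_coords g c = p - (s / R) *\<^sub>R 1"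
        by (simp add: c_def g linear_diff[OF linear_permute_coords] linear_scale[OF linear_permute_coords])
      then have "norm v = norm (p - (s / R) *\<^sub>R 1)"
        using inner_permute_coords[OF permutation_group_bij[OF sub g(1)], of c c] vc
        by (simp add: norm_eq_sqrt_inner)
      then have "norm v \<le> R * N\<^sup>2" using p(3) R_le by simp
      then show ?thesis using inv nz neq by (auto simp: v_def)
    next
      case False
      have "finite (perm_orbit \<Gamma> z)" by (simp add: perm_orbit_def)
      then have "closed (convex hull (perm_orbit \<Gamma> z))"
        by (intro compact_imp_closed compact_convex_hull finite_imp_compact)
      then obtain a b where a: "a \<bullet> p < b" "\<And>x. x \<in> convex hull (perm_orbit \<Gamma> z) \<Longrightarrow> a \<bullet> x > b"
        using separating_hyperplane_closed_point[OF convex_convex_hull _ False] by blast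
      have sep: "a \<bullet> p < a \<bullet> permute_coords g z" if "g \<in> \<Gamma>" for g
        using a(1) a(2)[of "permute_coords g z"] that hull_inc[of _ "perm_orbit \<Gamma> z"]
        by (force simp: perm_orbit_def)
      \<comment> \<open>All orbit points and \<open>p\<close> have coordinate sum \<open>s\<close>,
        so removing the all-ones component of \<open>a\<close> shifts both sides of the separation
        equally.\<close>
      define a' where "a' = a - (a \<bullet> 1 / R) *\<^sub>R 1"
      have a1: "a' \<bullet> 1 = 0" using one_one R_def by (simp add: a'_def inner_simps)
      have sep': "a' \<bullet> p < a' \<bullet> permute_coords g z" if "g \<in> \<Gamma>" for g
        using sep[OF that] p(2) orbit_sum[OF that]
        by (simp add: a'_def inner_simps inner_commute[of 1])
      then have "a' \<noteq> 0" using permutation_group_id[OF sub] by force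
      define u where "u = a' /\<^sub>R norm a'"
      have u: "norm u = 1" "u \<bullet> 1 = 0" using \<open>a' \<noteq> 0\<close> a1 by (simp_all add: u_def)
      have low: "- R \<le> u \<bullet> permute_coords g z" if "g \<in> \<Gamma>" for g
      proof -
        have "\<bar>u \<bullet> (p - (s / R) *\<^sub>R 1)\<bar> \<le> R"
          using Cauchy_Schwarz_ineq2[of u "p - (s / R) *\<^sub>R 1"] u(1) p(3) by simp
        then have "- R \<le> u \<bullet> p" using u(2) by (simp add: inner_simps)
        also have "\<dots> \<le> u \<bullet> permute_coords g z"
          using sep'[OF that] by (simp add: u_def mult_left_mono)
        finally show ?thesis .
      qed
      have card: "card \<Gamma> \<le> N" unfolding N_def by (simp add: card_mono)
      have "\<bar>u \<bullet> permute_coords g z\<bar> \<le> N * R" if "g \<in> \<Gamma>" for g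
        using inner_orbit_bound[OF \<Gamma> u(2) low that] mult_right_mono[OF card R] by simp
      then obtain V where V: "invariant_subspace \<Gamma> V" "V \<noteq> {0}" "1 \<notin> V"
        "(norm (orthogonal_projection V z))\<^sup>2 \<le> card \<Gamma> * (N * R)\<^sup>2"
        using invariant_subspace_small_projection[OF sub u] by metis
      note V(4)
      \<comment> \<open>Weakening \<open>card \<Gamma>\<close> to \<open>N\<^sup>2\<close> gives a
        perfect square, which avoids a square root in the constant.\<close>
      also have "card \<Gamma> * (N * R)\<^sup>2 \<le> N\<^sup>2 * (N * R)\<^sup>2"
        using card N self_le_power[of N 2] by (intro mult_right_mono) auto
      also have "\<dots> = (R * N\<^sup>2)\<^sup>2" by (simp add: power2_eq_square)
      finally have "norm (orthogonal_projection V z) \<le> R * N\<^sup>2"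
        using R by (simp add: power2_le_iff_abs_le)
      then show ?thesis using V one by blast
    qed
  qed
qed

end
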